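(* Let $k\geq 2$ be an integer and let $G$ be an edge-colored graph on $n\geq 2k+9$ vertices. If $\delta^c(G)\geq \frac{n+2k-3}{2}$, then $G$ contains $k$ rainbow triangles which pairwise share only one common vertex (the same vertex for all of them).
   Context: An edge-colored graph is a simple graph $G$ with a coloring $c:E(G)\to\mathbb{N}$ of its edges (not necessarily proper). For a vertex $v$, the color degree $d^c(v)$ is the number of distinct colors appearing on edges incident with $v$, and $\delta^c(G)=\min\{d^c(v):v\in V(G)\}$. A triangle is rainbow if its three edges have pairwise distinct colors. *)

theory Defs
  imports Complex_Main
begin

definition simple_graph :: "'a set \<Rightarrow> 'a set set \<Rightarrow> bool" where
  "simple_graph V E \<longleftrightarrow> finite V \<and> (\<forall>e\<in>E. e \<subseteq> V \<and> card e = 2)"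

(* An edge-colouring is a function on all vertex sets; only its values on E are ever used. *)

definition color_degree :: "'a set set \<Rightarrow> ('a set \<Rightarrow> nat) \<Rightarrow> 'a \<Rightarrow> nat" where
  "color_degree E c v = card (c ` {e \<in> E. v \<in> e})"

(* Meaningful only for finite nonempty V. *)
definition min_color_degree :: "'a set \<Rightarrow> 'a set set \<Rightarrow> ('a set \<Rightarrow> nat) \<Rightarrow> nat" where
  "min_color_degree V E c = Min (color_degree E c ` V)"

(* A triangle is identified with its set of three vertices. *)
definition rainbow_triangle :: "'a set set \<Rightarrow> ('a set \<Rightarrow> nat) \<Rightarrow> 'a set \<Rightarrow> bool" where
  "rainbow_triangle E c T \<longleftrightarrow>
     (\<exists>x y z. T = {x, y, z} \<and> distinct [x, y, z] \<and>
        {x, y} \<in> E \<and> {y, z} \<in> E \<and> {x, z} \<in> E \<and>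
        distinct [c {x, y}, c {y, z}, c {x, z}])"

end

theory Submission
  imports Defs
begin

text \<open>
  Write \<open>d(x)\<close> for the degree of \<open>x\<close> and \<open>t = d(x) - \<delta>\<close>. For an edge \<open>{x, v}\<close>, at least
  \<open>d(x) + \<delta> - n\<close> vertices \<open>y\<close> form a triangle with \<open>x\<close>, \<open>v\<close> in which \<open>{v, y}\<close> and \<open>{x, v}\<close> have
  different colours. Such a triangle is rainbow unless its two edges at \<open>x\<close> or its two edges at \<open>y\<close>
  have equal colours (a cherry centred at \<open>x\<close>, or one centred at \<open>y\<close>). Summed over all \<open>x\<close>, the two
  kinds of exceptions are equally frequent, and there are at most \<open>t (t + 1)\<close> cherries centred at \<open>x\<close>.

  For \<open>k = 2\<close> this yields more than \<open>n\<close> rainbow triangles, whereas a family of triples of which no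
  two share exactly one element has at most \<open>n\<close> members.

  For \<open>k \<ge> 3\<close> take a vertex \<open>x\<close> with at least as many exceptions of the first kind as of the second.
  If the graph of the pairs \<open>{v, y}\<close> that form a rainbow triangle with \<open>x\<close> had no matching of size
  \<open>k\<close>, then for some \<open>m < k\<close> there would be \<open>d(x) - m\<close> vertices with degree sum at most
  \<open>m (d(x) - 1)\<close>, which is too small.
\<close>

section \<open>Matchings of maximum size\<close>

text \<open>Edges come from a relation, so that for fixed \<open>x\<close> the relation
  \<open>rainbow x\<close> serves directly as a graph on the neighbourhood of
  \<open>x\<close>.\<close>

definition matching_on :: "'a set \<Rightarrow> ('a \<Rightarrow> 'a \<Rightarrow> bool) \<Rightarrow> 'a set set \<Rightarrow> bool" where
  "matching_on N R M \<longleftrightarrow>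
     (\<forall>e\<in>M. \<exists>a b. e = {a, b} \<and> a \<in> N \<and> b \<in> N \<and> a \<noteq> b \<and> R a b) \<and> pairwise disjnt M"

lemma matching_on_Union_subset: "matching_on N R M \<Longrightarrow> \<Union>M \<subseteq> N"
  unfolding matching_on_def by fastforce

lemma matching_on_finite: "matching_on N R M \<Longrightarrow> finite N \<Longrightarrow> finite M"
  by (meson finite_UnionD finite_subset matching_on_Union_subset)

lemma matching_on_card_Union:
  assumes "matching_on N R M"
  shows "card (\<Union>M) = 2 * card M"
proof -
  have two: "card e = 2" if "e \<in> M" for e
    using assms that unfolding matching_on_def by fastforce
  then have "card (\<Union>M) = sum card M"
    using assms unfolding matching_on_def
    by (intro card_Union_disjoint) (auto simp: card_ge_0_finite)
  then show ?thesis using two by simp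
qed

lemma matching_on_mono: "matching_on N R M \<Longrightarrow> M' \<subseteq> M \<Longrightarrow> matching_on N R M'"
  unfolding matching_on_def by (meson pairwise_subset subsetD)

lemma matching_on_eq:
  "matching_on N R M \<Longrightarrow> e \<in> M \<Longrightarrow> e' \<in> M \<Longrightarrow> v \<in> e \<Longrightarrow> v \<in> e' \<Longrightarrow> e = e'"
  unfolding matching_on_def pairwise_def disjnt_def by blast

lemma matching_on_insert:
  assumes "matching_on N R M" "a \<in> N - \<Union>M" "b \<in> N - \<Union>M" "a \<noteq> b" "R a b"
  shows "matching_on N R (insert {a, b} M)"
  using assms unfolding matching_on_def pairwise_insert disjnt_def by blast

lemma ex_maximum_matching:
  assumes "finite N"
  obtains M where "matching_on N R M" "\<And>M'. matching_on N R M' \<Longrightarrow> card M' \<le> card M"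
proof -
  have "matching_on N R {}" unfolding matching_on_def by simp
  moreover have "\<forall>M. matching_on N R M \<longrightarrow> card M < Suc (card N)"
  proof (intro allI impI)
    fix M assume M: "matching_on N R M"
    show "card M < Suc (card N)"
      using matching_on_card_Union[OF M] card_mono[OF assms matching_on_Union_subset[OF M]] by simp
  qed
  ultimately show thesis
    using that ex_has_greatest_nat[of "matching_on N R" "{}" card "Suc (card N)"]
    by (metis less_imp_le_nat)
qed

lemma maximum_matching_independent:
  assumes "finite N" "matching_on N R M" "\<And>M'. matching_on N R M' \<Longrightarrow> card M' \<le> card M"
    and "u \<in> N - \<Union>M" "w \<in> N - \<Union>M" "u \<noteq> w"
  shows "\<not> R u w"
proof
  assume "R u w"
  then have "matching_on N R (insert {u, w} M)"
    using assms by (intro matching_on_insert) auto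
  moreover have "{u, w} \<notin> M" using assms by blast
  ultimately show False
    using assms(3)[of "insert {u, w} M"] matching_on_finite[OF assms(2,1)] by simp
qed

text \<open>Otherwise \<open>u\<close>, \<open>a\<close>, \<open>b\<close>, \<open>w\<close> is an
  augmenting path: replacing \<open>{a, b}\<close> by \<open>{a, u}\<close> and
  \<open>{b, w}\<close> enlarges the matching.\<close>

lemma maximum_matching_no_augmentation:
  assumes "finite N" "matching_on N R M" "\<And>M'. matching_on N R M' \<Longrightarrow> card M' \<le> card M"
    and "{a, b} \<in> M" "u \<in> N - \<Union>M" "w \<in> N - \<Union>M" "R a u" "R b w" "a \<noteq> b"
  shows "u = w"
proof (rule ccontr)
  assume neq: "u \<noteq> w"
  define M1 where "M1 = M - {{a, b}}"
  have M1: "matching_on N R M1" using assms(2) matching_on_mono M1_def by blast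
  have ab: "a \<in> N" "b \<in> N" using assms(2,4) matching_on_Union_subset by blast+
  have fresh: "a \<notin> \<Union>M1" "b \<notin> \<Union>M1"
    using matching_on_eq[OF assms(2) _ assms(4)] unfolding M1_def by blast+
  have dist: "a \<noteq> u" "a \<noteq> w" "b \<noteq> u" "b \<noteq> w" using assms(4-6) by blast+
  have uw: "u \<notin> \<Union>M1" "w \<notin> \<Union>M1" using assms(5,6) M1_def by auto
  have M2: "matching_on N R (insert {a, u} M1)"
    using ab fresh uw dist assms(5,7) by (intro matching_on_insert[OF M1]) auto
  have M3: "matching_on N R (insert {b, w} (insert {a, u} M1))"
    using ab fresh uw dist assms(6,8,9) neq by (intro matching_on_insert[OF M2]) auto
  have fin: "finite M" using matching_on_finite[OF assms(2,1)] .
  have "{a, u} \<notin> M1" "{b, w} \<notin> insert {a, u} M1" using fresh dist assms(9) neq by (auto simp: doubleton_eq_iff)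
  then have "card (insert {b, w} (insert {a, u} M1)) = Suc (Suc (card M1))"
    using fin M1_def by simp
  moreover have "Suc (card M1) = card M" using card.remove[OF fin assms(4)] M1_def by simp
  ultimately show False using assms(3)[OF M3] by simp
qed

text \<open>A maximum matching with vertex set \<open>U\<close> leaves an independent set \<open>Q\<close>. As no edge of the
  matching can be augmented, each one has an end \<open>s\<close> with (almost) no neighbour in \<open>Q\<close>; the set
  \<open>S\<close> consists of \<open>Q\<close> and these ends.\<close>

lemma no_large_matching_degree_sum:
  fixes N :: "'a set"
  assumes fin: "finite N" and sym: "\<And>u v. R u v \<Longrightarrow> R v u" and irr: "\<And>u. \<not> R u u"
    and large: "2 * k + 1 \<le> card N"
    and no_matching: "\<not> (\<exists>M. matching_on N R M \<and> card M = k)"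
  obtains m S where "m < k" "S \<subseteq> N" "card S + m = card N"
    "(\<Sum>v\<in>S. card {y \<in> N. R v y}) \<le> m * (card N - 1)"
proof -
  obtain M where M: "matching_on N R M" and max: "\<And>M'. matching_on N R M' \<Longrightarrow> card M' \<le> card M"
    using ex_maximum_matching[OF fin] by blast
  define m U Q where "m = card M" and "U = \<Union>M" and "Q = N - U"
  have finM: "finite M" using M fin matching_on_finite by blast
  have mk: "m < k"
  proof (rule ccontr)
    assume "\<not> m < k"
    then obtain M' where "M' \<subseteq> M" "card M' = k"
      unfolding m_def by (meson not_less obtain_subset_with_card_n)
    then show False using no_matching M matching_on_mono by blast
  qed
  have UN: "U \<subseteq> N" using M U_def matching_on_Union_subset by blast
  have finU: "finite U" and finQ: "finite Q" using UN fin finite_subset Q_def by auto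
  have cU: "card U = 2 * m" using M matching_on_card_Union U_def m_def by blast
  have cN: "card N = card Q + 2 * m"
    using cU UN fin by (simp add: Q_def card_Diff_subset finU card_mono flip: cU)
  \<comment> \<open>At least (2k + 1) - 2(k - 1) vertices stay unmatched.\<close>
  have Q3: "3 \<le> card Q" using cN mk large by linarith
  let ?q = "\<lambda>v. card {y \<in> Q. R v y}"
  let ?u = "\<lambda>v. card {y \<in> U. R v y}"
  have deg: "card {y \<in> N. R v y} = ?q v + ?u v" for v
  proof -
    have "{y \<in> N. R v y} = {y \<in> Q. R v y} \<union> {y \<in> U. R v y}" using UN Q_def by auto
    moreover have "card ({y \<in> Q. R v y} \<union> {y \<in> U. R v y}) = ?q v + ?u v"
      using finU finQ by (intro card_Un_disjoint) (auto simp: Q_def)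
    ultimately show ?thesis by simp
  qed
  \<comment> \<open>Edges from \<open>e\<close> to \<open>Q\<close> are needed in full for the
    degrees of the vertices in \<open>Q\<close>, and again at \<open>s\<close> for its own degree.
    An end with no neighbour in \<open>Q\<close> keeps the total within
    \<open>card Q\<close>.\<close>
  have "\<exists>s\<in>e. (\<Sum>v\<in>e. ?q v) + ?q s \<le> card Q" if e: "e \<in> M" for e
  proof -
    obtain a b where ab: "e = {a, b}" "a \<noteq> b" using M e unfolding matching_on_def by metis
    define A B where "A = {y \<in> Q. R a y}" and "B = {y \<in> Q. R b y}"
    have AB: "A \<subseteq> Q" "B \<subseteq> Q" unfolding A_def B_def by auto
    have le: "card A \<le> card Q" "card B \<le> card Q" using AB finQ card_mono by auto
    have eq: "y = z" if "y \<in> A" "z \<in> B" for y z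
      using maximum_matching_no_augmentation[OF fin M max, of a b y z] that e ab
      unfolding A_def B_def Q_def U_def by simp
    have sum: "(\<Sum>v\<in>e. ?q v) = card A + card B" "?q a = card A" "?q b = card B"
      using ab A_def B_def by simp_all
    \<comment> \<open>By \<open>eq\<close>, two nonempty sets are the same singleton; the total is
      then 3, which is where \<open>Q3\<close> enters.\<close>
    consider "A = {}" | "B = {}" | y where "A = {y}" "B = {y}" using eq by blast
    then show ?thesis
    proof cases
      case 1
      then have "(\<Sum>v\<in>e. ?q v) + ?q a \<le> card Q" using sum le by simp
      then show ?thesis using ab by blast
    next
      case 2
      then have "(\<Sum>v\<in>e. ?q v) + ?q b \<le> card Q" using sum le by simp
      then show ?thesis using ab by blast
    next
      case 3
      then have "(\<Sum>v\<in>e. ?q v) + ?q a \<le> card Q" using sum Q3 by simp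
      then show ?thesis using ab by blast
    qed
  qed
  then obtain s where s: "\<And>e. e \<in> M \<Longrightarrow> s e \<in> e"
    "\<And>e. e \<in> M \<Longrightarrow> (\<Sum>v\<in>e. ?q v) + ?q (s e) \<le> card Q" by metis
  have disj: "e = e'" if "e \<in> M" "e' \<in> M" "v \<in> e" "v \<in> e'" for e e' v
    using matching_on_eq[OF M] that by blast
  have inj: "inj_on s M" using disj s(1) by (metis inj_onI)
  have sU: "s ` M \<subseteq> U" using s(1) U_def by auto
  define S where "S = Q \<union> s ` M"
  have QsM: "Q \<inter> s ` M = {}" using sU Q_def by auto
  have cS: "card S = card Q + m"
    unfolding S_def using QsM finQ finM inj m_def by (simp add: card_Un_disjoint card_image)
  \<comment> \<open>\<open>Q\<close> is independent, so every edge at \<open>Q\<close> leads to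
    \<open>U\<close> and can be counted from its end there.\<close>
  have Qdeg: "(\<Sum>v\<in>Q. card {y \<in> N. R v y}) = (\<Sum>e\<in>M. \<Sum>v\<in>e. ?q v)"
  proof -
    have "?q v = 0" if "v \<in> Q" for v
      using maximum_matching_independent[OF fin M max] that irr finQ unfolding Q_def U_def
      by (metis (mono_tags, lifting) card_eq_0_iff empty_Collect_eq)
    then have "(\<Sum>v\<in>Q. card {y \<in> N. R v y}) = (\<Sum>v\<in>Q. ?u v)" using deg by simp
    also have "\<dots> = (\<Sum>v\<in>Q. \<Sum>y\<in>U. of_bool (R v y))" using finU by (simp add: Int_def)
    also have "\<dots> = (\<Sum>y\<in>U. \<Sum>v\<in>Q. of_bool (R v y))" by (rule sum.swap)
    also have "\<dots> = (\<Sum>y\<in>U. \<Sum>v\<in>Q. of_bool (R y v))" using sym by (intro sum.cong refl arg_cong[where f = of_bool]) blast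
    also have "\<dots> = (\<Sum>y\<in>U. ?q y)" using finQ by (simp add: Int_def)
    also have "\<dots> = (\<Sum>e\<in>M. \<Sum>v\<in>e. ?q v)" unfolding U_def
      using disj finM finU U_def by (subst sum.Union_disjoint) (auto intro: finite_subset)
    finally show ?thesis .
  qed
  have "?u (s e) \<le> 2 * m - 1" if "e \<in> M" for e
  proof -
    have "{y \<in> U. R (s e) y} \<subseteq> U - {s e}" using irr by auto
    then have "?u (s e) \<le> card (U - {s e})" using finU by (intro card_mono) auto
    then show ?thesis using cU sU that finU by (auto simp: card_Diff_singleton)
  qed
  then have "card Q + (2 * m - 1) \<ge> (\<Sum>v\<in>e. ?q v) + (?q (s e) + ?u (s e))" if "e \<in> M" for e
    using that s(2)[OF that] by (simp add: add_mono flip: add.assoc)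
  then have "(\<Sum>e\<in>M. (\<Sum>v\<in>e. ?q v) + (?q (s e) + ?u (s e))) \<le> m * (card Q + (2 * m - 1))"
    unfolding m_def using sum_bounded_above[of M _ "card Q + (2 * card M - 1)"] by simp
  \<comment> \<open>For \<open>m = 0\<close> the subtraction in \<open>2 * m - 1\<close> truncates,
    but both products vanish.\<close>
  also have "\<dots> = m * (card N - 1)" using cN by (cases m) auto
  finally have "(\<Sum>e\<in>M. \<Sum>v\<in>e. ?q v) + (\<Sum>e\<in>M. card {y \<in> N. R (s e) y}) \<le> m * (card N - 1)"
    by (simp only: deg sum.distrib)
  moreover have "(\<Sum>v\<in>S. card {y \<in> N. R v y})
      = (\<Sum>e\<in>M. \<Sum>v\<in>e. ?q v) + (\<Sum>e\<in>M. card {y \<in> N. R (s e) y})"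
    unfolding S_def using QsM finQ finM inj Qdeg by (simp add: sum.union_disjoint sum.reindex)
  ultimately have "(\<Sum>v\<in>S. card {y \<in> N. R v y}) \<le> m * (card N - 1)"
    by simp
  moreover have "S \<subseteq> N" using sU UN S_def Q_def by auto
  ultimately show thesis using that mk cS cN by simp
qed

section \<open>Families of triples and colliding pairs\<close>

text \<open>The oddtown argument: modulo 2 the incidence vectors of the triples are orthonormal, so distinct
  subfamilies have distinct sums.\<close>

lemma card_triples_le:
  assumes V: "finite V" and sub: "\<And>T. T \<in> F \<Longrightarrow> T \<subseteq> V \<and> card T = 3"
    and meet: "\<And>T T'. T \<in> F \<Longrightarrow> T' \<in> F \<Longrightarrow> T \<noteq> T' \<Longrightarrow> card (T \<inter> T') \<noteq> 1"
  shows "card F \<le> card V"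
proof -
  have finF: "finite F" using V sub by (meson Pow_iff finite_Pow_iff finite_subset subsetI)
  \<comment> \<open>The sum modulo 2 of the incidence vectors of the triples in
    \<open>S\<close>.\<close>
  define g where "g S = {v \<in> V. odd (card {T \<in> S. v \<in> T})}" for S
  have parity: "odd (card (g S \<inter> T)) \<longleftrightarrow> T \<in> S" if S: "S \<subseteq> F" and T: "T \<in> F" for S T
  proof -
    have finS: "finite S" using S finF finite_subset by blast
    have finT: "finite T" using T sub V finite_subset by blast
    have "g S \<inter> T = {v \<in> T. odd (card {T' \<in> S. v \<in> T'})}" using sub T g_def by blast
    then have "odd (card (g S \<inter> T)) \<longleftrightarrow> odd (\<Sum>v\<in>T. card {T' \<in> S. v \<in> T'})"
      using even_sum_iff[OF finT, of "\<lambda>v. card {T' \<in> S. v \<in> T'}"] by presburger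
    also have "(\<Sum>v\<in>T. card {T' \<in> S. v \<in> T'}) = (\<Sum>v\<in>T. \<Sum>T'\<in>S. of_bool (v \<in> T'))"
      using finS by (simp add: Int_def)
    also have "\<dots> = (\<Sum>T'\<in>S. card (T \<inter> T'))"
      using finT by (subst sum.swap) (simp add: Int_def)
    also have "odd \<dots> \<longleftrightarrow> odd (card {T' \<in> S. odd (card (T \<inter> T'))})"
      using even_sum_iff[OF finS, of "\<lambda>T'. card (T \<inter> T')"] by presburger
    \<comment> \<open>A triple meets itself in 3 elements and any other member in 0 or 2.\<close>
    also have "{T' \<in> S. odd (card (T \<inter> T'))} = S \<inter> {T}"
    proof -
      have "odd (card (T \<inter> T')) \<longleftrightarrow> T' = T" if "T' \<in> S" for T'
      proof (cases "T' = T")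
        case True then show ?thesis using sub T by simp
      next
        case False
        have "T \<inter> T' \<subset> T"
          using False sub T that S by (metis inf_le1 card_subset_eq psubsetI inf_commute subsetD finite_subset V)
        then have "card (T \<inter> T') < 3" using psubset_card_mono[OF finT] sub T by metis
        moreover have "card (T \<inter> T') \<noteq> 1" using meet T that S False by blast
        ultimately have "card (T \<inter> T') = 0 \<or> card (T \<inter> T') = 2" by linarith
        then show ?thesis using False by auto
      qed
      then show ?thesis by auto
    qed
    finally show ?thesis by (cases "T \<in> S") simp_all
  qed
  have "inj_on g (Pow F)"
  proof (rule inj_onI)
    fix S S' assume S: "S \<in> Pow F" "S' \<in> Pow F" "g S = g S'"
    have "T \<in> S \<longleftrightarrow> T \<in> S'" for T
    proof (cases "T \<in> F")
      case True
      then show ?thesis using S parity[of S T] parity[of S' T] by simp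
    qed (use S in auto)
    then show "S = S'" by blast
  qed
  moreover have "g ` Pow F \<subseteq> Pow V" using g_def by auto
  ultimately have "card (Pow F) \<le> card (Pow V)" using V by (intro card_inj_on_le[of g]) auto
  then show ?thesis using V finF by (simp add: card_Pow)
qed

text \<open>Induction on \<open>N\<close>: an element with a new value creates no pair. Otherwise
  the deficit t rises by 1, the new element collides with at most t + 1 others, and t(t + 1) + 2(t +
  1) = (t + 1)(t + 2).\<close>

lemma card_collisions_le:
  assumes "finite N"
  shows "card {(u, v). u \<in> N \<and> v \<in> N \<and> u \<noteq> v \<and> f u = f v}
    \<le> (card N - card (f ` N)) * (card N - card (f ` N) + 1)"
  using assms
proof (induction N)
  case empty
  then show ?case by simp
next
  case (insert z N)
  define t where "t = card N - card (f ` N)"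
  define K where "K = {u \<in> N. f u = f z}"
  let ?P = "\<lambda>N. {(u, v). u \<in> N \<and> v \<in> N \<and> u \<noteq> v \<and> f u = f v}"
  have IH: "card (?P N) \<le> t * (t + 1)" using insert t_def by blast
  have finK: "finite K" using insert K_def by simp
  have le: "card (f ` N) \<le> card N" using insert card_image_le by blast
  show ?case
  proof (cases "f z \<in> f ` N")
    case False
    then have "?P (insert z N) = ?P N" by (auto simp: image_iff)
    then show ?thesis using insert IH t_def False by simp
  next
    case True
    \<comment> \<open>All of \<open>K\<close> shares one value, so \<open>f\<close> takes at most
      \<open>card N - card K + 1\<close> values on \<open>N\<close>.\<close>
    have K: "card K \<le> t + 1"
    proof -
      have "f ` N \<subseteq> insert (f z) (f ` (N - K))" using K_def by auto
      then have "card (f ` N) \<le> card (insert (f z) (f ` (N - K)))"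
        using insert by (intro card_mono) auto
      also have "\<dots> \<le> Suc (card (f ` (N - K)))"
        using insert by (simp add: card_insert_if)
      also have "card (f ` (N - K)) \<le> card (N - K)"
        using insert by (intro card_image_le) auto
      also have "card (N - K) = card N - card K" using finK K_def by (intro card_Diff_subset) auto
      finally show ?thesis using t_def card_mono[of N K] insert K_def by simp
    qed
    have "?P (insert z N) = ?P N \<union> ({z} \<times> K \<union> K \<times> {z})" using insert K_def by auto
    then have "card (?P (insert z N)) \<le> card (?P N) + card ({z} \<times> K \<union> K \<times> {z})"
      by (simp only: card_Un_le)
    also have "card ({z} \<times> K \<union> K \<times> {z}) \<le> card K + card K"
      using card_Un_le[of "{z} \<times> K" "K \<times> {z}"] by (simp add: card_cartesian_product)
    also have "card (?P N) + (card K + card K) \<le> (t + 1) * (t + 2)" using IH K by simp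
    finally show ?thesis using insert True t_def le by (simp add: insert_absorb Suc_diff_le)
  qed
qed

section \<open>Coloured neighbourhoods and cherries\<close>

locale edge_colored_graph =
  fixes V :: "'a set" and E :: "'a set set" and c :: "'a set \<Rightarrow> nat" and \<delta> :: nat
  assumes graph: "simple_graph V E"
    and color_degree_ge: "\<And>v. v \<in> V \<Longrightarrow> \<delta> \<le> color_degree E c v"
begin

definition nbrs :: "'a \<Rightarrow> 'a set" where
  "nbrs x = {y. {x, y} \<in> E}"

definition rainbow :: "'a \<Rightarrow> 'a \<Rightarrow> 'a \<Rightarrow> bool" where
  "rainbow x v y \<longleftrightarrow> v \<in> nbrs x \<and> y \<in> nbrs x \<and> y \<in> nbrs v \<and>
     c {x, v} \<noteq> c {x, y} \<and> c {x, v} \<noteq> c {v, y} \<and> c {x, y} \<noteq> c {v, y}"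

text \<open>The first argument is the centre. Monochromatic triangles are left out because only
  triangles with \<open>{v, y}\<close> and \<open>{x, v}\<close> of different colours arise in
  \<open>local_count\<close>.\<close>

definition cherry :: "'a \<Rightarrow> 'a \<Rightarrow> 'a \<Rightarrow> bool" where
  "cherry x v y \<longleftrightarrow> v \<in> nbrs x \<and> y \<in> nbrs x \<and> y \<in> nbrs v \<and>
     c {x, v} = c {x, y} \<and> c {v, y} \<noteq> c {x, y}"

text \<open>The number t of the overview; by \<open>delta_le_degree\<close> the subtraction is exact
  on \<open>V\<close>.\<close>

definition excess :: "'a \<Rightarrow> nat" where
  "excess x = card (nbrs x) - \<delta>"

text \<open>Leaves are ordered: a cherry contributes 2 at its centre here and 1 to
  \<open>ending\<close> at each leaf, whence the equal totals in \<open>sum_ending\<close>.\<close>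

definition centred :: "'a \<Rightarrow> nat" where
  "centred x = (\<Sum>v\<in>V. card {y \<in> V. cherry x v y})"

definition ending :: "'a \<Rightarrow> nat" where
  "ending x = (\<Sum>v\<in>V. card {y \<in> V. cherry y x v})"

lemma finite_V: "finite V"
  using graph unfolding simple_graph_def by blast

lemma edge_distinct: "{x, y} \<in> E \<Longrightarrow> x \<noteq> y"
  using graph unfolding simple_graph_def by fastforce

lemma nbrs_subset: "nbrs x \<subseteq> V"
  using graph unfolding simple_graph_def nbrs_def by blast

lemma nbrs_finite [simp]: "finite (nbrs x)"
  using finite_V finite_subset nbrs_subset by blast

lemma nbrs_sym: "y \<in> nbrs x \<longleftrightarrow> x \<in> nbrs y"
  unfolding nbrs_def by (simp add: insert_commute)

lemma nbrs_irrefl [simp]: "x \<notin> nbrs x"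
  using edge_distinct unfolding nbrs_def by blast

lemma rainbow_irrefl: "\<not> rainbow x v v"
  unfolding rainbow_def by simp

lemma rainbow_sym: "rainbow x v y \<Longrightarrow> rainbow x y v"
  unfolding rainbow_def using nbrs_sym by (auto simp: insert_commute)

lemma rainbow_triangleI: "rainbow x v y \<Longrightarrow> rainbow_triangle E c {x, v, y}"
  unfolding rainbow_def rainbow_triangle_def nbrs_def
  using edge_distinct by (intro exI[of _ x] exI[of _ v] exI[of _ y]) auto

lemma color_degree_eq: "color_degree E c v = card ((\<lambda>y. c {v, y}) ` nbrs v)"
proof -
  have "e \<in> (\<lambda>y. {v, y}) ` nbrs v" if "e \<in> E" "v \<in> e" for e
  proof -
    have "card e = 2" using graph that unfolding simple_graph_def by blast
    then obtain a b where "e = {a, b}" by (meson card_2_iff)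
    then show ?thesis using that unfolding nbrs_def by (auto simp: insert_commute)
  qed
  then have "{e \<in> E. v \<in> e} = (\<lambda>y. {v, y}) ` nbrs v"
    unfolding nbrs_def by auto
  then show ?thesis unfolding color_degree_def by (simp add: image_image)
qed

lemma delta_le_degree: "x \<in> V \<Longrightarrow> \<delta> \<le> card (nbrs x)"
  using color_degree_ge color_degree_eq card_image_le nbrs_finite by (metis order_trans)

lemma degree_less_card: "x \<in> V \<Longrightarrow> card (nbrs x) < card V"
  using nbrs_subset nbrs_irrefl finite_V by (intro psubset_card_mono) blast+

section \<open>Counting rainbow triangles at a vertex\<close>

text \<open>The colours at \<open>v\<close> other than that of \<open>{x, v}\<close> occur on at most \<open>n - 1 - d(x)\<close> edges leaving the
  closed neighbourhood of \<open>x\<close>; the remaining ones close a triangle with \<open>x\<close>.\<close>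

lemma local_count:
  assumes x: "x \<in> V" and v: "v \<in> nbrs x"
  shows "card (nbrs x) + \<delta> \<le> card V + card {y \<in> V. rainbow x v y}
    + card {y \<in> V. cherry x v y} + card {y \<in> V. cherry y x v}"
proof -
  let ?R = "{y \<in> V. rainbow x v y}" and ?C = "{y \<in> V. cherry x v y}" and ?I = "{y \<in> V. cherry y x v}"
  define W where "W = V - nbrs x - {x}"
  define f where "f y = c {v, y}" for y
  have vV: "v \<in> V" using v nbrs_subset by blast
  have "f ` nbrs v \<subseteq> insert (f x) (f ` (W \<union> ?R \<union> ?C \<union> ?I))"
  proof
    fix a assume "a \<in> f ` nbrs v"
    then obtain y where y: "y \<in> nbrs v" "a = f y" by blast
    have yV: "y \<in> V" using y nbrs_subset by blast
    show "a \<in> insert (f x) (f ` (W \<union> ?R \<union> ?C \<union> ?I))"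
    proof (cases "y \<in> W \<or> a = f x")
      case True
      then show ?thesis using y by blast
    next
      case False
      then have yx: "y \<in> nbrs x" "f y \<noteq> f x" using y yV W_def by auto
      \<comment> \<open>If the triangle is not rainbow, \<open>{x, y}\<close> repeats the colour of
        \<open>{x, v}\<close> or of \<open>{v, y}\<close>, which are different.\<close>
      have "rainbow x v y \<or> cherry x v y \<or> cherry y x v"
        unfolding rainbow_def cherry_def using yx y v nbrs_sym
        by (auto simp: insert_commute f_def)
      then show ?thesis using y yV by blast
    qed
  qed
  then have "card (f ` nbrs v) \<le> card (insert (f x) (f ` (W \<union> ?R \<union> ?C \<union> ?I)))"
    using finite_V W_def by (intro card_mono) auto
  also have "\<dots> \<le> Suc (card (f ` (W \<union> ?R \<union> ?C \<union> ?I)))"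
    by (simp add: card_insert_le_m1)
  also have "card (f ` (W \<union> ?R \<union> ?C \<union> ?I)) \<le> card (W \<union> ?R \<union> ?C \<union> ?I)"
    using finite_V W_def by (intro card_image_le) auto
  also have "\<dots> \<le> card W + card ?R + card ?C + card ?I"
    by (meson add_mono card_Un_le order_refl order_trans)
  finally have "card (f ` nbrs v) \<le> Suc (card W + card ?R + card ?C + card ?I)" by simp
  moreover have "\<delta> \<le> card (f ` nbrs v)"
    using color_degree_ge[OF vV] color_degree_eq f_def by simp
  \<comment> \<open>The 1 removed for \<open>x\<close> cancels the 1 spent on the colour
    \<open>f x\<close>.\<close>
  moreover have "card W = card V - card (nbrs x) - 1"
    unfolding W_def using x nbrs_subset by (simp add: card_Diff_subset)
  ultimately show ?thesis using degree_less_card[OF x] by linarith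
qed

text \<open>The leaves of a cherry centred at \<open>x\<close> are neighbours with colliding
  colours, and at least \<open>\<delta>\<close> colours occur at \<open>x\<close>, so the deficit in
  \<open>card_collisions_le\<close> is at most \<open>excess x\<close>.\<close>

lemma centred_le:
  assumes "x \<in> V"
  shows "centred x \<le> excess x * (excess x + 1)"
proof -
  let ?f = "\<lambda>y. c {x, y}"
  have "centred x = card (SIGMA v:V. {y \<in> V. cherry x v y})"
    unfolding centred_def using finite_V by simp
  also have "\<dots> \<le> card {(u, v). u \<in> nbrs x \<and> v \<in> nbrs x \<and> u \<noteq> v \<and> ?f u = ?f v}"
  proof (rule card_mono)
    show "finite {(u, v). u \<in> nbrs x \<and> v \<in> nbrs x \<and> u \<noteq> v \<and> ?f u = ?f v}"
      by (rule finite_subset[of _ "nbrs x \<times> nbrs x"]) auto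
  qed (auto simp: cherry_def)
  also have "\<dots> \<le> (card (nbrs x) - card (?f ` nbrs x)) * (card (nbrs x) - card (?f ` nbrs x) + 1)"
    by (rule card_collisions_le) simp
  also have "\<dots> \<le> excess x * (excess x + 1)"
    using color_degree_ge[OF assms] color_degree_eq[of x] unfolding excess_def
    by (intro mult_mono) auto
  finally show ?thesis .
qed

lemma sum_ending: "(\<Sum>x\<in>V. ending x) = (\<Sum>x\<in>V. centred x)"
proof -
  have "(\<Sum>x\<in>V. ending x) = (\<Sum>x\<in>V. \<Sum>v\<in>V. \<Sum>y\<in>V. of_bool (cherry y x v))"
    unfolding ending_def using finite_V by (simp add: Int_def)
  also have "\<dots> = (\<Sum>x\<in>V. \<Sum>y\<in>V. \<Sum>v\<in>V. of_bool (cherry y x v))"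
    by (intro sum.cong refl sum.swap)
  also have "\<dots> = (\<Sum>y\<in>V. \<Sum>x\<in>V. \<Sum>v\<in>V. of_bool (cherry y x v))"
    by (rule sum.swap)
  also have "\<dots> = (\<Sum>x\<in>V. centred x)"
    unfolding centred_def using finite_V by (simp add: Int_def)
  finally show ?thesis .
qed

text \<open>Sums \<open>local_count\<close> over \<open>S\<close>, enlarging the cherry counts to
  all of \<open>V\<close>. The matching bound supplies a particular \<open>S\<close>; the case of
  two triangles takes \<open>S = nbrs x\<close>.\<close>

lemma sum_local_count:
  assumes x: "x \<in> V" and S: "S \<subseteq> nbrs x"
  shows "card S * (card (nbrs x) + \<delta>) \<le> card S * card V + (\<Sum>v\<in>S. card {y \<in> nbrs x. rainbow x v y})
    + centred x + ending x"
proof -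
  have SV: "S \<subseteq> V" using S nbrs_subset by blast
  have eq: "{y \<in> V. rainbow x v y} = {y \<in> nbrs x. rainbow x v y}" for v
    using nbrs_subset unfolding rainbow_def by blast
  have "card S * (card (nbrs x) + \<delta>) \<le> (\<Sum>v\<in>S. card V + card {y \<in> V. rainbow x v y}
    + card {y \<in> V. cherry x v y} + card {y \<in> V. cherry y x v})"
    using sum_bounded_below[of S "card (nbrs x) + \<delta>"] local_count[OF x] S by (simp add: subset_iff)
  also have "\<dots> = card S * card V + (\<Sum>v\<in>S. card {y \<in> V. rainbow x v y})
    + (\<Sum>v\<in>S. card {y \<in> V. cherry x v y}) + (\<Sum>v\<in>S. card {y \<in> V. cherry y x v})"
    by (simp add: sum.distrib)
  also have "\<dots> \<le> card S * card V + (\<Sum>v\<in>S. card {y \<in> V. rainbow x v y}) + centred x + ending x"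
    unfolding centred_def ending_def using finite_V SV
    by (intro add_mono sum_mono2 order_refl) auto
  finally show ?thesis using eq by simp
qed

text \<open>The vertices of a triangle have 6 orderings.\<close>

lemma rainbow_triples_le:
  assumes "finite {T. rainbow_triangle E c T}"
  shows "(\<Sum>x\<in>V. \<Sum>v\<in>nbrs x. card {y \<in> nbrs x. rainbow x v y}) \<le> 6 * card {T. rainbow_triangle E c T}"
proof -
  define P where "P T = {(x, v, y). {x, v, y} \<subseteq> T \<and> x \<noteq> v \<and> x \<noteq> y \<and> v \<noteq> y}" for T :: "'a set"
  let ?F = "{T. rainbow_triangle E c T}"
  have P6: "finite (P T) \<and> card (P T) \<le> 6" if T_in: "T \<in> ?F" for T
  proof -
    obtain p q r where T: "T = {p, q, r}"
      using T_in unfolding rainbow_triangle_def by blast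
    define L where "L = [(p,q,r),(p,r,q),(q,p,r),(q,r,p),(r,p,q),(r,q,p)]"
    have "P T \<subseteq> set L"
      unfolding P_def L_def T by auto
    moreover have "card (set L) \<le> 6" using card_length[of L] L_def by simp
    ultimately show ?thesis
      by (meson card_mono finite_set finite_subset order_trans)
  qed
  have "(\<Sum>x\<in>V. \<Sum>v\<in>nbrs x. card {y \<in> nbrs x. rainbow x v y})
      = card (SIGMA x:V. SIGMA v:nbrs x. {y \<in> nbrs x. rainbow x v y})"
    using finite_V by simp
  also have "\<dots> \<le> card (\<Union>T\<in>?F. P T)"
  proof (rule card_mono)
    show "finite (\<Union>T\<in>?F. P T)" using assms P6 by blast
    show "(SIGMA x:V. SIGMA v:nbrs x. {y \<in> nbrs x. rainbow x v y}) \<subseteq> (\<Union>T\<in>?F. P T)"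
    proof clarsimp
      fix x v y assume r: "rainbow x v y"
      then have "x \<noteq> v" "x \<noteq> y" "v \<noteq> y"
        unfolding rainbow_def using nbrs_irrefl by blast+
      then show "\<exists>T. rainbow_triangle E c T \<and> (x, v, y) \<in> P T"
        using rainbow_triangleI[OF r] P_def by auto
    qed
  qed
  also have "\<dots> \<le> (\<Sum>T\<in>?F. card (P T))" by (rule card_UN_le[OF assms])
  also have "\<dots> \<le> 6 * card ?F" using P6 sum_bounded_above[of ?F "\<lambda>T. card (P T)" 6] by simp
  finally show ?thesis .
qed

lemma rainbow_triangle_subset: "rainbow_triangle E c T \<Longrightarrow> T \<subseteq> V \<and> card T = 3"
  using graph unfolding rainbow_triangle_def simple_graph_def by fastforce

section \<open>Two triangles\<close>

text \<open>Without such a pair, \<open>card_triples_le\<close> leaves at most 6n ordered rainbow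
  triples, whereas the local counts sum to at least 7n.\<close>

lemma two_rainbow_triangles:
  assumes "V \<noteq> {}" and delta: "card V + 1 \<le> 2 * \<delta>" "7 \<le> \<delta>"
  shows "\<exists>T T'. rainbow_triangle E c T \<and> rainbow_triangle E c T' \<and> card (T \<inter> T') = 1"
proof (rule ccontr)
  assume none: "\<not> ?thesis"
  let ?F = "{T. rainbow_triangle E c T}"
  let ?r = "\<lambda>x. \<Sum>v\<in>nbrs x. card {y \<in> nbrs x. rainbow x v y}"
  have finF: "finite ?F"
    using finite_subset[of ?F "Pow V"] rainbow_triangle_subset finite_V by auto
  have "card ?F \<le> card V"
    using none rainbow_triangle_subset finite_V by (intro card_triples_le) auto
  then have upper: "(\<Sum>x\<in>V. ?r x) \<le> 6 * card V"
    using rainbow_triples_le[OF finF] by linarith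
  have "7 + centred x \<le> ?r x + ending x" if x: "x \<in> V" for x
  proof -
    define d t where "d = int (card (nbrs x))" and "t = int (excess x)"
    have d: "d = int \<delta> + t" "t \<ge> 0"
      using delta_le_degree[OF x] d_def t_def excess_def by simp_all
    have dn: "d < int (card V)" using degree_less_card[OF x] d_def by simp
    have "int (card (nbrs x) * (card (nbrs x) + \<delta>))
      \<le> int (card (nbrs x) * card V + ?r x + centred x + ending x)"
      using sum_local_count[OF x order_refl] by (subst of_nat_le_iff)
    then have 1: "d * (d + int \<delta> - int (card V)) \<le> int (?r x) + int (centred x) + int (ending x)"
      unfolding d_def by (simp add: algebra_simps)
    have "int (centred x) \<le> int (excess x * (excess x + 1))"
      using centred_le[OF x] by (subst of_nat_le_iff)
    then have 2: "int (centred x) \<le> t * (t + 1)" unfolding t_def by (simp add: algebra_simps)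
    \<comment> \<open>Here \<open>d = \<delta> + t\<close> and
      \<open>card V + 1 \<le> 2 * \<delta>\<close> yield the factor \<open>t + 1\<close>.\<close>
    have "d * (t + 1) \<le> d * (d + int \<delta> - int (card V))"
      using d delta by (intro mult_left_mono) auto
    \<comment> \<open>From \<open>d < card V \<le> 2 * \<delta> - 1\<close> follows
      \<open>t \<le> \<delta> - 2\<close>.\<close>
    moreover have "t * (int \<delta> - t) \<ge> t * 2" if "t > 0"
      using d dn delta by (intro mult_left_mono) auto
    then have "t * (int \<delta> - t) \<ge> t * 2" using d by fastforce
    \<comment> \<open>d(t + 1) - 2t(t + 1) equals \<open>\<delta> + t * (\<delta> - t) - t\<close>,
      which is at least \<open>\<delta>\<close>.\<close>
    ultimately have "7 + 2 * (t * (t + 1)) \<le> d * (d + int \<delta> - int (card V))"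
      using d delta by (simp add: algebra_simps)
    then show ?thesis using 1 2 by linarith
  qed
  then have "(\<Sum>x\<in>V. 7 + centred x) \<le> (\<Sum>x\<in>V. ?r x + ending x)" by (rule sum_mono)
  then have "7 * card V \<le> (\<Sum>x\<in>V. ?r x)" using sum_ending by (simp add: sum.distrib)
  then have "card V = 0" using upper by linarith
  then show False using assms(1) finite_V by simp
qed

section \<open>Three or more triangles\<close>

lemma ex_rainbow_matching:
  assumes "V \<noteq> {}" and k: "3 \<le> k" and delta: "card V + 2 * k \<le> 2 * \<delta> + 3" "2 * k + 3 \<le> \<delta>"
  shows "\<exists>x M. matching_on (nbrs x) (rainbow x) M \<and> card M = k"
proof -
  \<comment> \<open>The totals of \<open>ending\<close> and \<open>centred\<close> agree, so
    \<open>ending\<close> cannot be larger at every vertex.\<close>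
  obtain x where x: "x \<in> V" and le: "ending x \<le> centred x"
  proof (rule ccontr)
    assume "\<not> thesis"
    then have "(\<Sum>x\<in>V. centred x) < (\<Sum>x\<in>V. ending x)"
      using that finite_V assms(1) by (intro sum_strict_mono) (auto simp: not_le[symmetric])
    then show False using sum_ending by simp
  qed
  have "\<exists>M. matching_on (nbrs x) (rainbow x) M \<and> card M = k"
  proof (rule ccontr)
    assume none: "\<not> ?thesis"
    define d t where "d = int (card (nbrs x))" and "t = int (excess x)"
    have d: "d = int \<delta> + t" "t \<ge> 0"
      using delta_le_degree[OF x] d_def t_def excess_def by simp_all
    have dn: "d < int (card V)" using degree_less_card[OF x] d_def by simp
    have large: "2 * k + 1 \<le> card (nbrs x)" using delta_le_degree[OF x] delta by linarith
    obtain m S where mS: "m < k" "S \<subseteq> nbrs x" "card S + m = card (nbrs x)"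
      "(\<Sum>v\<in>S. card {y \<in> nbrs x. rainbow x v y}) \<le> m * (card (nbrs x) - 1)"
      using no_large_matching_degree_sum[of "nbrs x" "rainbow x" k, OF nbrs_finite rainbow_sym rainbow_irrefl large none]
      by blast
    define \<mu> s where "\<mu> = int m" and "s = int (card S)"
    have s: "s = d - \<mu>" using mS(3) by (simp add: d_def \<mu>_def s_def)
    have "int (centred x) \<le> int (excess x * (excess x + 1))"
      using centred_le[OF x] by (subst of_nat_le_iff)
    then have c: "int (centred x) \<le> t * (t + 1)" unfolding t_def by (simp add: algebra_simps)
    have "int (card S * (card (nbrs x) + \<delta>)) \<le> int (card S * card V
        + (\<Sum>v\<in>S. card {y \<in> nbrs x. rainbow x v y}) + centred x + ending x)"
      using sum_local_count[OF x mS(2)] by (subst of_nat_le_iff)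
    then have 1: "s * (d + int \<delta> - int (card V))
        \<le> int (\<Sum>v\<in>S. card {y \<in> nbrs x. rainbow x v y}) + int (centred x) + int (ending x)"
      unfolding d_def s_def by (simp add: algebra_simps)
    have "int (\<Sum>v\<in>S. card {y \<in> nbrs x. rainbow x v y}) \<le> int (m * (card (nbrs x) - 1))"
      using mS(4) by (subst of_nat_le_iff)
    also have "\<dots> = \<mu> * (d - 1)" using large by (simp add: \<mu>_def d_def of_nat_diff)
    finally have 2: "s * (d + int \<delta> - int (card V)) \<le> \<mu> * (d - 1) + 2 * (t * (t + 1))"
      using 1 c le by linarith
    \<comment> \<open>The largest value that \<open>\<mu>\<close> can take; in terms of it, d +
      \<open>\<delta>\<close> - n is at least \<open>2 * K - 1 + t\<close>.\<close>
    define K where "K = int k - 1"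
    have K: "2 \<le> K" "\<mu> \<le> K" "0 \<le> \<mu>" using k mS(1) by (auto simp: K_def \<mu>_def)
    have "s * (2 * K - 1 + t) \<le> s * (d + int \<delta> - int (card V))"
      using d delta K_def s_def by (intro mult_left_mono) auto
    with 2 have 3: "(d - \<mu>) * (2 * K - 1 + t) \<le> \<mu> * (d - 1) + 2 * (t * (t + 1))" using s by simp
    \<comment> \<open>Inequality 3 weakens as \<open>\<mu>\<close> grows, at rate
      \<open>d + 2 * K - 2 + t\<close>, so \<open>\<mu>\<close> may be replaced by
      \<open>K\<close>.\<close>
    have "(K - \<mu>) * (d + 2 * K - 2 + t) \<ge> 0" using K d delta by (intro mult_nonneg_nonneg) auto
    with 3 have 4: "(d - K) * (2 * K - 1 + t) \<le> K * (d - 1) + 2 * (t * (t + 1))"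
      by (simp add: algebra_simps)
    \<comment> \<open>\<open>d < card V\<close> and the first bound in \<open>delta\<close> give
      \<open>2 * t \<le> h\<close>; \<open>\<delta> \<ge> 2 * k + 3 = 2 * K + 5\<close> gives
      \<open>5 \<le> h\<close>.\<close>
    define h where "h = d - 2 * K"
    have h: "2 * t \<le> h" "5 \<le> h" using d dn delta K_def h_def by auto
    have 5: "h * (K - 1 + t) + K * t \<le> 2 * (t * (t + 1))"
    proof -
      have "d = h + 2 * K" using h_def by simp
      then show ?thesis using 4 by (simp add: algebra_simps)
    qed
    \<comment> \<open>As \<open>K \<ge> 2\<close>, the left side of 5 is at least 2t(t + 1) + 2t,
      which forces t = 0; the term h(K - 1) then contradicts 5.\<close>
    have "h * (1 + t) \<le> h * (K - 1 + t)" using K h by (intro mult_left_mono) auto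
    moreover have "2 * t * (1 + t) \<le> h * (1 + t)" using h d by (intro mult_right_mono) auto
    moreover have "2 * t \<le> K * t" using K d by (intro mult_right_mono) auto
    ultimately have "t = 0" using 5 d by (simp add: algebra_simps)
    with 5 have "h * (K - 1) \<le> 0" by simp
    moreover have "h * (K - 1) > 0" using h K by (intro mult_pos_pos) auto
    ultimately show False by simp
  qed
  then show ?thesis by blast
qed

text \<open>Matching edges are disjoint and avoid \<open>x\<close>, so adding \<open>x\<close> to
  each is injective and yields triangles sharing \<open>x\<close> alone.\<close>

lemma rainbow_matching_imp_friendship:
  assumes M: "matching_on (nbrs x) (rainbow x) M"
  shows "finite (insert x ` M) \<and> card (insert x ` M) = card M \<and>
    (\<forall>T\<in>insert x ` M. rainbow_triangle E c T \<and> x \<in> T) \<and>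
    (\<forall>T\<in>insert x ` M. \<forall>T'\<in>insert x ` M. T \<noteq> T' \<longrightarrow> T \<inter> T' = {x})"
proof -
  have x: "x \<notin> e" if "e \<in> M" for e
    using matching_on_Union_subset[OF M] that nbrs_irrefl by blast
  then have "inj_on (insert x) M" by (intro inj_onI) (metis insert_ident)
  moreover have "rainbow_triangle E c (insert x e)" if "e \<in> M" for e
    using M that rainbow_triangleI unfolding matching_on_def by metis
  moreover have "insert x e \<inter> insert x e' = {x}" if "e \<in> M" "e' \<in> M" "e \<noteq> e'" for e e'
    using M that unfolding matching_on_def pairwise_def disjnt_def by blast
  ultimately show ?thesis
    using matching_on_finite[OF M] by (auto simp: card_image)
qed

end

theorem theorem4:
  fixes V :: "'a set" and E :: "'a set set" and c :: "'a set \<Rightarrow> nat" and n k :: nat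
  assumes "k \<ge> 2"
    and "simple_graph V E"
    and "card V = n"
    and "n \<ge> 2 * k + 9"
    and "real (min_color_degree V E c) \<ge> (real n + 2 * real k - 3) / 2"
  shows "\<exists>v \<T>. finite \<T> \<and> card \<T> = k \<and>
           (\<forall>T\<in>\<T>. rainbow_triangle E c T \<and> v \<in> T) \<and>
           (\<forall>T\<in>\<T>. \<forall>T'\<in>\<T>. T \<noteq> T' \<longrightarrow> T \<inter> T' = {v})"
proof -
  define \<delta> where "\<delta> = min_color_degree V E c"
  have V: "finite V" "V \<noteq> {}" using assms unfolding simple_graph_def by auto
  interpret edge_colored_graph V E c \<delta>
    using assms(2) V by unfold_locales (auto simp: \<delta>_def min_color_degree_def)
  have "real n + 2 * real k \<le> 2 * real \<delta> + 3" using assms(5) \<delta>_def by simp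
  then have delta: "card V + 2 * k \<le> 2 * \<delta> + 3" using assms(3) by linarith
  \<comment> \<open>\<open>2 * \<delta> \<ge> n + 2 * k - 3 \<ge> 4 * k + 6\<close>; for
    \<open>k = 2\<close> this is the bound \<open>7 \<le> \<delta>\<close>.\<close>
  then have delta': "2 * k + 3 \<le> \<delta>" using assms(3,4) by linarith
  show ?thesis
  proof (cases "k = 2")
    case True
    obtain T T' where T: "rainbow_triangle E c T" "rainbow_triangle E c T'" "card (T \<inter> T') = 1"
      using two_rainbow_triangles[OF V(2)] delta delta' True by auto
    obtain v where v: "T \<inter> T' = {v}" using T(3) by (auto simp: card_1_singleton_iff)
    have "T \<noteq> T'" using T rainbow_triangle_subset by fastforce
    then show ?thesis using T v True by (intro exI[of _ v] exI[of _ "{T, T'}"]) auto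
  next
    case False
    then obtain x M where M: "matching_on (nbrs x) (rainbow x) M" "card M = k"
      using ex_rainbow_matching[OF V(2) _ delta delta'] assms(1) by auto
    show ?thesis
      using rainbow_matching_imp_friendship[OF M(1)] M(2) by (intro exI[of _ x] exI[of _ "insert x ` M"]) simp
  qed
qed

end
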